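(* Let $G$ be a graph with $m$ edges satisfying $\lambda(G) > \sqrt{m}$, where $\lambda(G)$ is the largest eigenvalue of the adjacency matrix of $G$. Then $bk(G) > \frac{1}{144}\sqrt{m}$. Furthermore, there exist graphs $G$ with $m$ edges and $\lambda(G) > \sqrt{m}$ (for infinitely many $m$) with $bk(G) \le (\frac{1}{3}+o(1))\sqrt{m}$, where $o(1)\to 0$ as $m\to\infty$.
   Context: All graphs are finite, simple and undirected. A book of size $k$, denoted $B_k$, is the graph consisting of $k$ triangles sharing a common edge. For a graph $G$, $bk(G)$ denotes the largest $k$ such that $G$ contains $B_k$ as a subgraph (equivalently, the maximum over edges $\{u,v\}$ of the number of common neighbors of $u$ and $v$). *)

theory Defs
  imports "Jordan_Normal_Form.Spectral_Radius"
begin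

definition simple_graph :: "'a set \<Rightarrow> 'a set set \<Rightarrow> bool" where
  "simple_graph V E \<longleftrightarrow> finite V \<and> (\<forall>e\<in>E. e \<subseteq> V \<and> card e = 2)"

text \<open>The list \<open>vs\<close> fixes the order of the rows and columns. A diagonal entry
  is 0 because the singleton \<open>{v}\<close> is never an edge.\<close>

definition adj_matrix :: "'a list \<Rightarrow> 'a set set \<Rightarrow> real mat" where
  "adj_matrix vs E =
     mat (length vs) (length vs) (\<lambda>(i, j). if {vs ! i, vs ! j} \<in> E then 1 else 0)"

lemma eigenvalue_adj_matrix_iff:
  assumes "distinct vs"
  shows "eigenvalue (adj_matrix vs E) k \<longleftrightarrow>
    (\<exists>x. (\<exists>v\<in>set vs. x v \<noteq> 0) \<and>
         (\<forall>v\<in>set vs. (\<Sum>u\<in>set vs. (if {v, u} \<in> E then 1 else 0) * x u) = k * x v))"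
    (is "?L \<longleftrightarrow> (\<exists>x. ?P x)")
proof -
  let ?n = "length vs"
  have bij: "bij_betw ((!) vs) {0..<?n} (set vs)"
    using assms by (simp add: atLeast0LessThan bij_betw_nth)
  have sum_nth: "(\<Sum>u\<in>set vs. f u) = (\<Sum>j\<in>{0..<?n}. f (vs ! j))" for f :: "'a \<Rightarrow> real"
    using sum.reindex_bij_betw[OF bij, of f] by simp
  have key: "eigenvector (adj_matrix vs E) (vec ?n (\<lambda>i. x (vs ! i))) k \<longleftrightarrow> ?P x" for x
  proof -
    have ne: "vec ?n (\<lambda>i. x (vs ! i)) \<noteq> 0\<^sub>v ?n \<longleftrightarrow> (\<exists>v\<in>set vs. x v \<noteq> 0)"
      by (auto simp: vec_eq_iff in_set_conv_nth) (metis nth_mem)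
    have "adj_matrix vs E *\<^sub>v vec ?n (\<lambda>i. x (vs ! i)) = k \<cdot>\<^sub>v vec ?n (\<lambda>i. x (vs ! i)) \<longleftrightarrow>
        (\<forall>i<?n. (\<Sum>j\<in>{0..<?n}. (if {vs ! i, vs ! j} \<in> E then 1 else 0) * x (vs ! j))
                = k * x (vs ! i))"
      by (auto simp: vec_eq_iff adj_matrix_def scalar_prod_def row_def)
    also have "\<dots> \<longleftrightarrow>
        (\<forall>v\<in>set vs. (\<Sum>u\<in>set vs. (if {v, u} \<in> E then 1 else 0) * x u) = k * x v)"
      unfolding sum_nth by (auto simp: all_set_conv_all_nth)
    finally show ?thesis
      using ne by (simp add: eigenvector_def adj_matrix_def)
  qed
  show ?thesis
  proof
    assume ?L
    then obtain w where w: "eigenvector (adj_matrix vs E) w k"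
      by (auto simp: eigenvalue_def)
    define x where "x v = w $ (inv_into {0..<?n} ((!) vs) v)" for v
    have "x (vs ! i) = w $ i" if "i < ?n" for i
      using that bij by (simp add: x_def bij_betw_def inv_into_f_f)
    moreover have "dim_vec w = ?n"
      using w by (auto simp: eigenvector_def adj_matrix_def)
    ultimately have "w = vec ?n (\<lambda>i. x (vs ! i))"
      by (auto simp: vec_eq_iff)
    with w key[of x] show "\<exists>x. ?P x" by auto
  next
    assume "\<exists>x. ?P x"
    with key show ?L unfolding eigenvalue_def by blast
  qed
qed

lemma spectrum_adj_matrix_cong:
  assumes "distinct vs" "distinct ws" "set vs = set ws"
  shows "spectrum (adj_matrix vs E) = spectrum (adj_matrix ws E)"
  unfolding spectrum_def
  by (rule Collect_cong) (simp add: eigenvalue_adj_matrix_iff assms)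

text \<open>The spectrum does not depend on the chosen enumeration
  (\<open>spectrum_adj_matrix_cong\<close>). The graph without vertices, whose adjacency matrix
  has no eigenvalue, gets the value 0.\<close>

definition largest_eigenvalue :: "'a set \<Rightarrow> 'a set set \<Rightarrow> real" where
  "largest_eigenvalue V E =
     (if V = {} then 0
      else Max (spectrum (adj_matrix (SOME vs. distinct vs \<and> set vs = V) E)))"

definition contains_subgraph ::
    "'a set \<Rightarrow> 'a set set \<Rightarrow> 'b set \<Rightarrow> 'b set set \<Rightarrow> bool" where
  "contains_subgraph V E W F \<longleftrightarrow>
     (\<exists>f. inj_on f W \<and> f ` W \<subseteq> V \<and> (\<forall>e\<in>F. f ` e \<in> E))"

text \<open>In the book with \<open>k\<close> pages, 0 and 1 span the common edge and
  \<open>2, \<dots>, k + 1\<close> are the third vertices of the triangles.\<close>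

definition book_verts :: "nat \<Rightarrow> nat set" where
  "book_verts k = {0..<k + 2}"

definition book_edges :: "nat \<Rightarrow> nat set set" where
  "book_edges k = {{0, 1}} \<union> (\<Union>i\<in>{2..<k + 2}. {{0, i}, {1, i}})"

text \<open>A graph without edges does not even contain the book with no pages (a single edge);
  its book number is set to 0.\<close>

definition bk :: "'a set \<Rightarrow> 'a set set \<Rightarrow> nat" where
  "bk V E =
     (if E = {} then 0 else Max {k. contains_subgraph V E (book_verts k) (book_edges k)})"

end

theory Submission
  imports Defs "HOL-Analysis.Function_Topology"
begin

text \<open>
  Lower bound. Normalise a nonnegative eigenvector \<open>x\<close> of the largest eigenvalue \<open>\<mu>\<close> so that its
  maximum is \<open>x s = 1\<close>, and let \<open>N\<close> be the neighbourhood of \<open>s\<close> and \<open>U\<close> the complement of \<open>N\<close>.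
  Counting walks of length two from \<open>s\<close>, the inequality \<open>\<mu>\<^sup>2 > m\<close> says that the gain, the sum of
  \<open>x v + x v' - 1\<close> over the edges \<open>v v'\<close> inside \<open>N\<close>, exceeds the loss \<open>e(U) + (\<Sum>w\<in>U. d\<^sub>N(w) (1 - x w))\<close>.
  If all books have at most \<open>k\<close> pages then every vertex of \<open>N\<close> has at most \<open>k\<close> neighbours in \<open>N\<close>, so the
  gain is at most \<open>k \<mu>\<close> and the loss is small. Hence \<open>U\<close> contains a set \<open>U1\<close> of more than \<open>3 k\<close>
  vertices that see at least half of the weight of \<open>N\<close>. Since the ends of an edge inside \<open>N\<close> have at
  most \<open>k\<close> common neighbours, they miss together at least \<open>2 k\<close> vertices of \<open>U1\<close>, and the eigenvalue
  equation turns every missing pair into a loss. Distributing this loss over the at most \<open>k\<close> edges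
  at each vertex of \<open>N\<close> shows that it is at least the gain. The argument needs only \<open>24 k \<le> \<mu>\<close>.

  Upper bound. A blow-up of the tensor product of \<open>K\<^sub>3\<close> and \<open>K\<^sub>4\<close> with all 12 classes of size \<open>t\<close> is
  \<open>6 t\<close>-regular with \<open>36 t\<^sup>2\<close> edges, and any two adjacent vertices have \<open>2 t\<close> common neighbours. As 1 is
  an eigenvalue of this tensor product, changing four class sizes by \<open>\<plusminus>1\<close> along an eigenvector keeps the number
  \<open>n = 12 t\<close> of vertices and raises the number of edges to \<open>36 t\<^sup>2 + 2 > n\<^sup>2 / 4\<close>, so that the average
  degree already exceeds \<open>\<surd>m\<close>.
\<close>

section \<open>A nonnegative eigenvector for the largest eigenvalue\<close>

text \<open>The quadratic form of \<open>A\<close> attains its maximum on the unit sphere by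
  compactness. Since \<open>A\<close> is nonnegative, the entrywise absolute value of a maximiser is
  again a maximiser, and the first-order condition there is the eigenvalue equation.\<close>

lemma rayleigh_maximizer:
  fixes A :: "'a \<Rightarrow> 'a \<Rightarrow> real"
  assumes fin: "finite V" and ne: "V \<noteq> {}"
    and A0: "\<And>u v. 0 \<le> A u v" and sym: "\<And>u v. A u v = A v u"
  obtains x \<mu> where "\<And>v. 0 \<le> x v" "\<exists>v\<in>V. x v \<noteq> 0"
    "\<And>v. v \<in> V \<Longrightarrow> (\<Sum>u\<in>V. A v u * x u) = \<mu> * x v"
    "\<And>y. (\<Sum>u\<in>V. \<Sum>v\<in>V. A u v * y u * y v) \<le> \<mu> * (\<Sum>v\<in>V. (y v)\<^sup>2)"
proof -
  define Q where "Q y = (\<Sum>u\<in>V. \<Sum>v\<in>V. A u v * y u * y v)" for y :: "'a \<Rightarrow> real"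
  \<comment> \<open>Coordinates outside \<open>V\<close> are pinned to 0, which makes the product
    over the whole type compact by Tychonoff's theorem.\<close>
  define B where "B v = (if v \<in> V then {-1..1} else {0 :: real})" for v
  define S where "S = PiE UNIV B \<inter> {y. (\<Sum>v\<in>V. (y v)\<^sup>2) = 1}"
  have coord: "continuous_on X (\<lambda>y. y v)" for X :: "('a \<Rightarrow> real) set" and v
    by (rule continuous_on_subset[OF continuous_on_product_coordinates]) simp
  have "compact (PiE UNIV B)"
    unfolding euclidean_product_topology[symmetric] compactin_euclidean_iff[symmetric] compactin_PiE
    by (auto simp: B_def)
  moreover have "closed {y :: 'a \<Rightarrow> real. (\<Sum>v\<in>V. (y v)\<^sup>2) = 1}"
    by (intro closed_Collect_eq continuous_intros coord)
  ultimately have "compact S" unfolding S_def by (rule compact_Int_closed)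
  moreover have "S \<noteq> {}"
  proof -
    obtain v where "v \<in> V" using ne by blast
    then have "(\<lambda>u. if u = v then 1 else 0) \<in> S"
      using fin by (auto simp: S_def B_def if_distrib[of "\<lambda>z. z\<^sup>2"] cong: if_cong)
    then show ?thesis by blast
  qed
  moreover have "continuous_on S Q" unfolding Q_def by (intro continuous_intros coord)
  ultimately obtain z where z: "z \<in> S" and max: "\<And>y. y \<in> S \<Longrightarrow> Q y \<le> Q z"
    using continuous_attains_sup by metis
  have z1: "(\<Sum>v\<in>V. (z v)\<^sup>2) = 1" using z by (simp add: S_def)
  define x where "x v = \<bar>z v\<bar>" for v
  define \<mu> where "\<mu> = Q z"
  have rayleigh: "Q y \<le> \<mu> * (\<Sum>v\<in>V. (y v)\<^sup>2)" for y
  proof (cases "\<forall>v\<in>V. y v = 0")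
    case True
    then show ?thesis by (simp add: Q_def)
  next
    case False
    define q where "q = (\<Sum>v\<in>V. (y v)\<^sup>2)"
    have q: "0 < q" using False fin unfolding q_def by (auto intro: sum_pos2)
    define y' where "y' v = (if v \<in> V then y v / sqrt q else 0)" for v
    have sq: "(\<Sum>v\<in>V. (y' v)\<^sup>2) = 1"
      using q by (simp add: y'_def power_divide sum_divide_distrib[symmetric] q_def[symmetric])
    have "\<bar>y' v\<bar> \<le> 1" if "v \<in> V" for v
    proof -
      have "(y' v)\<^sup>2 \<le> 1" unfolding sq[symmetric] using that fin by (intro member_le_sum) auto
      then show ?thesis by (simp add: abs_square_le_1)
    qed
    moreover have "y' v = 0" if "v \<notin> V" for v using that by (simp add: y'_def)
    ultimately have "y' \<in> S" using sq by (auto simp: S_def B_def abs_le_iff minus_le_iff)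
    then have "Q y' \<le> \<mu>" using max by (simp add: \<mu>_def)
    moreover have "Q y' = Q y / q"
    proof -
      have "Q y' = (\<Sum>u\<in>V. \<Sum>v\<in>V. A u v * y u * y v / q)"
        unfolding Q_def y'_def using q by (intro sum.cong) (auto simp: field_simps)
      then show ?thesis by (simp add: Q_def sum_divide_distrib[symmetric])
    qed
    ultimately show ?thesis using q by (simp add: q_def[symmetric] field_simps)
  qed
  have x1: "(\<Sum>v\<in>V. (x v)\<^sup>2) = 1" using z1 by (simp add: x_def)
  have "Q z \<le> Q x"
    unfolding Q_def
  proof (intro sum_mono)
    fix u v
    have "A u v * (z u * z v) \<le> A u v * (x u * x v)"
      using abs_ge_self[of "z u * z v"] A0 by (intro mult_left_mono) (auto simp: x_def abs_mult)
    then show "A u v * z u * z v \<le> A u v * x u * x v" by (simp add: mult.assoc)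
  qed
  then have Qx: "Q x = \<mu>" using rayleigh[of x] x1 by (simp add: \<mu>_def)
  have eig: "(\<Sum>u\<in>V. A v u * x u) = \<mu> * x v" if v: "v \<in> V" for v
  proof -
    define b where "b = (\<Sum>u\<in>V. A v u * x u) - \<mu> * x v"
    \<comment> \<open>\<open>c\<close> exceeds the size of the quadratic coefficient in
      \<open>quad\<close>, so at \<open>t = b / c\<close> the linear term wins unless the defect
      \<open>b\<close> vanishes.\<close>
    define c where "c = \<bar>A v v - \<mu>\<bar> + 1"
    define e where "e u = (if u = v then 1 else 0 :: real)" for u
    have Q_shift: "Q (\<lambda>u. x u + t * e u) = \<mu> + 2 * t * (\<Sum>u\<in>V. A v u * x u) + t\<^sup>2 * A v v" for t
    proof -
      have e: "(\<Sum>u\<in>V. e u * f u) = f v" for f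
      proof -
        have "(\<Sum>u\<in>V. e u * f u) = (\<Sum>u\<in>V. if u = v then f u else 0)"
          by (intro sum.cong) (auto simp: e_def)
        then show ?thesis using fin v by simp
      qed
      have "Q (\<lambda>u. x u + t * e u) = (\<Sum>u\<in>V. \<Sum>w\<in>V. A u w * x u * x w + t * (e u * (A u w * x w))
          + t * (e w * (A u w * x u)) + t\<^sup>2 * (e u * (e w * A u w)))"
        unfolding Q_def by (intro sum.cong refl) (simp add: algebra_simps power2_eq_square)
      also have "\<dots> = Q x + t * (\<Sum>u\<in>V. e u * (\<Sum>w\<in>V. A u w * x w))
          + t * (\<Sum>u\<in>V. \<Sum>w\<in>V. e w * (A u w * x u)) + t\<^sup>2 * (\<Sum>u\<in>V. e u * (\<Sum>w\<in>V. e w * A u w))"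
        by (simp only: Q_def sum.distrib sum_distrib_left)
      finally have "Q (\<lambda>u. x u + t * e u) = Q x + t * (\<Sum>u\<in>V. e u * (\<Sum>w\<in>V. A u w * x w))
          + t * (\<Sum>u\<in>V. \<Sum>w\<in>V. e w * (A u w * x u)) + t\<^sup>2 * (\<Sum>u\<in>V. e u * (\<Sum>w\<in>V. e w * A u w))" .
      moreover have "(\<Sum>u\<in>V. A u v * x u) = (\<Sum>u\<in>V. A v u * x u)"
        by (subst sym) (rule refl)
      ultimately show ?thesis by (simp add: e Qx)
    qed
    have sq_shift: "(\<Sum>u\<in>V. (x u + t * e u)\<^sup>2) = 1 + 2 * t * x v + t\<^sup>2" for t
    proof -
      have "(\<Sum>u\<in>V. (x u + t * e u)\<^sup>2) = (\<Sum>u\<in>V. (x u)\<^sup>2 + (if u = v then 2 * t * x v + t\<^sup>2 else 0))"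
        by (intro sum.cong) (auto simp: e_def power2_eq_square algebra_simps)
      then show ?thesis using fin v x1 by (simp add: sum.distrib)
    qed
    \<comment> \<open>The Rayleigh inequality is an equality at \<open>t = 0\<close>, so no constant
      term remains.\<close>
    have quad: "2 * t * b + t\<^sup>2 * (A v v - \<mu>) \<le> 0" for t
      using rayleigh[of "\<lambda>u. x u + t * e u"] unfolding Q_shift sq_shift b_def
      by (simp add: algebra_simps)
    have c: "0 < c" "- c < A v v - \<mu>" by (auto simp: c_def)
    have "0 \<le> (b / c)\<^sup>2 * (A v v - \<mu> + c)" using c by simp
    moreover have "(b / c)\<^sup>2 * (A v v - \<mu> + c) = (2 * (b / c) * b + (b / c)\<^sup>2 * (A v v - \<mu>)) - b\<^sup>2 / c"
      using c by (simp add: field_simps power2_eq_square)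
    ultimately have "b\<^sup>2 / c \<le> 0" using quad[of "b / c"] by linarith
    then have "b = 0" using c by (simp add: divide_le_0_iff)
    then show ?thesis by (simp add: b_def)
  qed
  have "\<exists>v\<in>V. x v \<noteq> 0"
  proof (rule ccontr)
    assume "\<not> ?thesis"
    then have "(\<Sum>v\<in>V. (x v)\<^sup>2) = 0" by simp
    then show False using x1 by simp
  qed
  then show ?thesis
    using that[of x \<mu>] eig rayleigh by (simp add: Q_def x_def)
qed

section \<open>Adjacency sums of a graph and the spectrum of its adjacency matrix\<close>

abbreviation adj :: "'a set set \<Rightarrow> 'a \<Rightarrow> 'a \<Rightarrow> real" where
  "adj E u v \<equiv> (if {u, v} \<in> E then 1 else 0)"

lemma adj_sym: "adj E u v = adj E v u"
  by (simp add: insert_commute)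

lemma simple_graph_finite_edges:
  assumes "simple_graph V E"
  shows "finite E"
proof -
  have "E \<subseteq> Pow V" "finite V" using assms by (auto simp: simple_graph_def)
  then show ?thesis using finite_subset by blast
qed

lemma sum_adj_eq_twice_card_edges:
  assumes G: "simple_graph V E"
  shows "(\<Sum>u\<in>V. \<Sum>v\<in>V. adj E u v) = 2 * real (card E)"
proof -
  have fin: "finite V" using G by (simp add: simple_graph_def)
  define P where "P e = {p\<in>V \<times> V. {fst p, snd p} = e}" for e
  have finP: "finite (P e)" for e using fin by (simp add: P_def)
  have "card (P e) = 2" if e: "e \<in> E" for e
  proof -
    obtain a b where ab: "e = {a, b}" "a \<noteq> b"
      using G e by (auto simp: simple_graph_def card_2_iff)
    then have "P e = {(a, b), (b, a)}"
      using G e by (auto simp: P_def simple_graph_def doubleton_eq_iff)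
    then show ?thesis using ab by simp
  qed
  then have "card (\<Union>e\<in>E. P e) = 2 * card E"
    using simple_graph_finite_edges[OF G] finP
    by (subst card_UN_disjoint) (auto simp: P_def)
  moreover have "(\<Union>e\<in>E. P e) = {p\<in>V \<times> V. {fst p, snd p} \<in> E}"
    by (auto simp: P_def)
  moreover have "(\<Sum>u\<in>V. \<Sum>v\<in>V. adj E u v) = real (card {p\<in>V \<times> V. {fst p, snd p} \<in> E})"
    unfolding sum.cartesian_product using fin
    by (simp add: case_prod_beta sum.If_cases Int_def)
  ultimately show ?thesis by simp
qed

text \<open>The maximal Rayleigh quotient is itself an eigenvalue, and every eigenvalue is the
  Rayleigh quotient of its own eigenvector, so the maximum of the spectrum is the maximal Rayleigh
  quotient.\<close>

lemma largest_eigenvalue_perron: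
  assumes G: "simple_graph V E" and ne: "V \<noteq> {}"
  obtains x where "\<And>v. 0 \<le> x v" "\<exists>v\<in>V. x v \<noteq> 0"
    "\<And>v. v \<in> V \<Longrightarrow> (\<Sum>u\<in>V. adj E v u * x u) = largest_eigenvalue V E * x v"
    "\<And>y. (\<Sum>u\<in>V. \<Sum>v\<in>V. adj E u v * y u * y v) \<le> largest_eigenvalue V E * (\<Sum>v\<in>V. (y v)\<^sup>2)"
proof -
  have fin: "finite V" using G by (simp add: simple_graph_def)
  obtain x \<mu> where x: "\<And>v. 0 \<le> x v" "\<exists>v\<in>V. x v \<noteq> 0"
    "\<And>v. v \<in> V \<Longrightarrow> (\<Sum>u\<in>V. adj E v u * x u) = \<mu> * x v"
    "\<And>y. (\<Sum>u\<in>V. \<Sum>v\<in>V. adj E u v * y u * y v) \<le> \<mu> * (\<Sum>v\<in>V. (y v)\<^sup>2)"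
  proof (rule rayleigh_maximizer[OF fin ne, of "adj E"])
    show "0 \<le> adj E u v" for u v by simp
  qed (rule adj_sym, blast)
  define vs where "vs = (SOME vs. distinct vs \<and> set vs = V)"
  have vs: "distinct vs" "set vs = V"
    using someI_ex[of "\<lambda>vs. distinct vs \<and> set vs = V"] finite_distinct_list[OF fin]
    unfolding vs_def by blast+
  let ?S = "spectrum (adj_matrix vs E)"
  have S: "c \<in> ?S \<longleftrightarrow> (\<exists>y. (\<exists>v\<in>V. y v \<noteq> 0) \<and> (\<forall>v\<in>V. (\<Sum>u\<in>V. adj E v u * y u) = c * y v))" for c
    unfolding spectrum_def mem_Collect_eq eigenvalue_adj_matrix_iff[OF vs(1)] vs(2) ..
  have finS: "finite ?S"
    by (rule card_finite_spectrum[of _ "length vs"]) (simp add: adj_matrix_def)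
  have "Max ?S = \<mu>"
  proof (rule Max_eqI[OF finS])
    show "\<mu> \<in> ?S" unfolding S using x by blast
    fix c assume "c \<in> ?S"
    then obtain y where y: "\<exists>v\<in>V. y v \<noteq> 0" "\<And>v. v \<in> V \<Longrightarrow> (\<Sum>u\<in>V. adj E v u * y u) = c * y v"
      unfolding S by blast
    have "c * (\<Sum>v\<in>V. (y v)\<^sup>2) = (\<Sum>v\<in>V. y v * (c * y v))"
      by (simp add: sum_distrib_left power2_eq_square mult_ac)
    also have "\<dots> = (\<Sum>v\<in>V. y v * (\<Sum>u\<in>V. adj E v u * y u))"
      using y(2) by (intro sum.cong) auto
    also have "\<dots> = (\<Sum>v\<in>V. \<Sum>u\<in>V. adj E v u * y v * y u)"
      by (simp add: sum_distrib_left mult_ac)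
    also have "\<dots> \<le> \<mu> * (\<Sum>v\<in>V. (y v)\<^sup>2)" by (rule x(4))
    finally show "c \<le> \<mu>" using y(1) fin sum_pos2[OF fin, of _ "\<lambda>v. (y v)\<^sup>2"] by auto
  qed
  then have "largest_eigenvalue V E = \<mu>"
    using ne by (simp add: largest_eigenvalue_def vs_def)
  then show ?thesis using that[of x] x by simp
qed

section \<open>Books and common neighbours\<close>

definition common_nbrs :: "'a set \<Rightarrow> 'a set set \<Rightarrow> 'a \<Rightarrow> 'a \<Rightarrow> 'a set" where
  "common_nbrs V E u v = {w\<in>V. {u, w} \<in> E \<and> {v, w} \<in> E}"

text \<open>The edge \<open>{u, v}\<close> becomes the spine and common neighbours become pages.
  Absence of loops keeps \<open>u\<close> and \<open>v\<close> out of their common neighbourhood,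
  which makes the embedding injective.\<close>

lemma contains_book_iff:
  assumes G: "simple_graph V E"
  shows "contains_subgraph V E (book_verts k) (book_edges k) \<longleftrightarrow>
    (\<exists>u v. {u, v} \<in> E \<and> k \<le> card (common_nbrs V E u v))"
proof
  assume "contains_subgraph V E (book_verts k) (book_edges k)"
  then obtain f where f: "inj_on f (book_verts k)" "f ` book_verts k \<subseteq> V"
    and e: "\<And>e. e \<in> book_edges k \<Longrightarrow> f ` e \<in> E"
    unfolding contains_subgraph_def by blast
  have "{f 0, f 1} \<in> E" using e[of "{0, 1}"] by (simp add: book_edges_def)
  moreover have "k \<le> card (common_nbrs V E (f 0) (f 1))"
  proof -
    have sub: "{2..<k+2} \<subseteq> book_verts k" by (auto simp: book_verts_def)
    have "{0, i} \<in> book_edges k" "{1, i} \<in> book_edges k" if "i \<in> {2..<k+2}" for i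
      using that unfolding book_edges_def by blast+
    then have "{f 0, f i} \<in> E" "{f 1, f i} \<in> E" if "i \<in> {2..<k+2}" for i
      using that e[of "{0, i}"] e[of "{1, i}"] by auto
    then have "f ` {2..<k+2} \<subseteq> common_nbrs V E (f 0) (f 1)"
      using f(2) sub unfolding common_nbrs_def by blast
    moreover have "finite (common_nbrs V E (f 0) (f 1))"
      using G by (simp add: common_nbrs_def simple_graph_def)
    moreover have "card (f ` {2..<k+2}) = k"
      using card_image[OF inj_on_subset[OF f(1) sub]] by simp
    ultimately show ?thesis by (metis card_mono)
  qed
  ultimately show "\<exists>u v. {u, v} \<in> E \<and> k \<le> card (common_nbrs V E u v)" by blast
next
  assume "\<exists>u v. {u, v} \<in> E \<and> k \<le> card (common_nbrs V E u v)"
  then obtain u v where uv: "{u, v} \<in> E" and k: "k \<le> card (common_nbrs V E u v)" by blast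
  have irrefl: "{w} \<notin> E" for w using G by (auto simp: simple_graph_def)
  obtain C where C: "C \<subseteq> common_nbrs V E u v" "card C = k" "finite C"
    using k by (metis obtain_subset_with_card_n)
  obtain g where g: "bij_betw g {2..<k+2} C"
    using C finite_same_card_bij[of "{2..<k+2}" C] by auto
  define f where "f i = (if i = 0 then u else if i = 1 then v else g i)" for i :: nat
  have gC: "g i \<in> common_nbrs V E u v" if "i \<in> {2..<k+2}" for i
    using g that C by (auto simp: bij_betw_def)
  have uv_notin: "u \<notin> common_nbrs V E u v" "v \<notin> common_nbrs V E u v" "u \<noteq> v"
    using irrefl uv by (auto simp: common_nbrs_def)
  have verts: "book_verts k = insert 0 (insert 1 {2..<k+2})" by (auto simp: book_verts_def)
  have f_img: "f i = g i" if "i \<in> {2..<k+2}" for i using that by (auto simp: f_def)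
  have "inj_on f {2..<k+2}"
    using g f_img by (auto simp: bij_betw_def inj_on_def)
  moreover have "f 0 \<notin> f ` {2..<k+2}" "f 1 \<notin> f ` {2..<k+2}"
    using f_img gC uv_notin by (auto simp: f_def[of 0] f_def[of "Suc 0"])
  ultimately have "inj_on f (book_verts k)"
    using uv_notin by (auto simp: verts f_def[of 0] f_def[of "Suc 0"])
  moreover have "f ` book_verts k \<subseteq> V"
    using uv G gC f_img by (auto simp: verts f_def[of 0] f_def[of "Suc 0"] simple_graph_def common_nbrs_def)
  moreover have "\<forall>e\<in>book_edges k. f ` e \<in> E"
    using uv gC f_img by (auto simp: book_edges_def f_def[of 0] f_def[of "Suc 0"] common_nbrs_def)
  ultimately show "contains_subgraph V E (book_verts k) (book_edges k)"
    unfolding contains_subgraph_def by blast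
qed

lemma finite_contained_books:
  assumes G: "simple_graph V E"
  shows "finite {k. contains_subgraph V E (book_verts k) (book_edges k)}"
proof (rule finite_subset)
  have "finite V" using G by (simp add: simple_graph_def)
  then show "{k. contains_subgraph V E (book_verts k) (book_edges k)} \<subseteq> {..card V}"
    by (auto simp: contains_book_iff[OF G] common_nbrs_def intro: order_trans card_mono)
qed simp

lemma common_nbrs_le_bk:
  assumes G: "simple_graph V E" and "{u, v} \<in> E"
  shows "card (common_nbrs V E u v) \<le> bk V E"
  using assms finite_contained_books[OF G]
  by (auto simp: bk_def contains_book_iff[OF G] intro!: Max_ge)

lemma bk_leI:
  assumes G: "simple_graph V E"
    and le: "\<And>u v. {u, v} \<in> E \<Longrightarrow> card (common_nbrs V E u v) \<le> k"
  shows "bk V E \<le> k"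
proof (cases "E = {}")
  case False
  let ?S = "{k. contains_subgraph V E (book_verts k) (book_edges k)}"
  obtain u v where "{u, v} \<in> E"
    using False G by (metis card_2_iff ex_in_conv simple_graph_def)
  \<comment> \<open>An edge alone is the book without pages, so the maximum is over a nonempty set
    and is attained.\<close>
  then have "0 \<in> ?S" by (auto simp: contains_book_iff[OF G])
  then have "Max ?S \<in> ?S" using finite_contained_books[OF G] by (intro Max_in) auto
  then have "bk V E \<in> ?S" using False by (simp add: bk_def)
  then show ?thesis using le by (fastforce simp: contains_book_iff[OF G])
qed (simp add: bk_def)

lemma sum_adj_mult_adj:
  assumes "finite V"
  shows "(\<Sum>w\<in>V. adj E u w * adj E v w) = real (card (common_nbrs V E u v))"
proof -
  have "(\<Sum>w\<in>V. adj E u w * adj E v w) = (\<Sum>w\<in>V. if {u, w} \<in> E \<and> {v, w} \<in> E then 1 else 0)"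
    by (intro sum.cong) auto
  then show ?thesis using assms by (simp add: sum.If_cases Int_def common_nbrs_def)
qed

section \<open>The lower bound\<close>

text \<open>The contrapositive of the lower bound in matrix form: for the adjacency matrix of a
  graph the double sum is twice the number of edges.\<close>

lemma no_small_codegree:
  fixes A :: "'a \<Rightarrow> 'a \<Rightarrow> real" and x :: "'a \<Rightarrow> real"
  assumes fin: "finite V"
    and A01: "\<And>u v. A u v = 0 \<or> A u v = 1"
    and sym: "\<And>u v. A u v = A v u"
    and codeg: "\<And>u v. \<lbrakk>u \<in> V; v \<in> V; A u v = 1\<rbrakk> \<Longrightarrow> (\<Sum>w\<in>V. A u w * A v w) \<le> k"
    and x: "\<And>v. v \<in> V \<Longrightarrow> 0 \<le> x v \<and> x v \<le> 1"
    and s: "s \<in> V" "x s = 1"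
    and eig: "\<And>v. v \<in> V \<Longrightarrow> (\<Sum>u\<in>V. A v u * x u) = \<mu> * x v"
    and \<mu>: "0 < \<mu>" "24 * k \<le> \<mu>"
  shows "2 * \<mu>\<^sup>2 \<le> (\<Sum>u\<in>V. \<Sum>v\<in>V. A u v)"
proof (rule ccontr)
  assume "\<not> ?thesis"
  then have large: "(\<Sum>u\<in>V. \<Sum>v\<in>V. A u v) < 2 * \<mu>\<^sup>2" by simp
  have A0: "0 \<le> A u v" and A1: "A u v \<le> 1" for u v
    using A01[of u v] by auto
  define N where "N = {v\<in>V. A s v = 1}"
  define U where "U = V - N"
  have finN: "finite N" and finU: "finite U" and NV: "N \<subseteq> V" and UV: "U \<subseteq> V"
    using fin by (auto simp: N_def U_def)
  have split: "sum f V = sum f N + sum f U" for f :: "'a \<Rightarrow> real"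
    unfolding U_def using sum.subset_diff[OF NV fin, of f] by simp
  have sum_nbhd: "(\<Sum>v\<in>V. A s v * f v) = sum f N" for f :: "'a \<Rightarrow> real"
  proof -
    have "(\<Sum>v\<in>U. A s v * f v) = 0"
      using A01[of s] by (intro sum.neutral) (auto simp: U_def N_def)
    moreover have "(\<Sum>v\<in>N. A s v * f v) = sum f N"
      by (intro sum.cong) (auto simp: N_def)
    ultimately show ?thesis by (simp add: split)
  qed
  define dN where "dN z = (\<Sum>v\<in>N. A z v)" for z
  define dU where "dU z = (\<Sum>v\<in>U. A z v)" for z
  have dN0: "0 \<le> dN z" and dU0: "0 \<le> dU z" for z
    by (auto simp: dN_def dU_def intro: sum_nonneg A0)
  have xN: "(\<Sum>v\<in>N. x v) = \<mu>"
    using eig[OF s(1)] s(2) sum_nbhd[of x] by simp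
  have walks: "\<mu>\<^sup>2 = (\<Sum>z\<in>V. dN z * x z)"
  proof -
    have "\<mu>\<^sup>2 = (\<Sum>v\<in>N. \<mu> * x v)"
      by (simp add: power2_eq_square sum_distrib_left[symmetric] xN)
    also have "\<dots> = (\<Sum>v\<in>N. \<Sum>z\<in>V. A v z * x z)"
      using eig NV by (intro sum.cong) auto
    also have "\<dots> = (\<Sum>z\<in>V. \<Sum>v\<in>N. A v z * x z)" by (rule sum.swap)
    also have "\<dots> = (\<Sum>z\<in>V. dN z * x z)"
      by (simp add: dN_def sum_distrib_right sym)
    finally show ?thesis .
  qed
  have edges: "(\<Sum>u\<in>V. \<Sum>v\<in>V. A u v) = sum dN N + 2 * sum dN U + sum dU U"
  proof -
    have "(\<Sum>v\<in>N. dU v) = (\<Sum>u\<in>U. dN u)"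
      unfolding dU_def dN_def by (subst sum.swap) (simp add: sym)
    then show ?thesis
      by (simp add: split[of "A _"] split[of "\<lambda>u. sum (A u) N + _ u"] dN_def[symmetric] dU_def[symmetric] sum.distrib split)
  qed
  \<comment> \<open>The gain of an edge inside \<open>N\<close> is split evenly between its ends. As
    \<open>sum dU U\<close> counts each edge inside \<open>U\<close> twice, the comparison
    \<open>gain\<close> is stated with both sides doubled.\<close>
  define G where "G = (\<Sum>v\<in>N. dN v * (x v - 1/2))"
  define D where "D = (\<Sum>u\<in>U. dN u * (1 - x u))"
  have "2 * G = 2 * (\<Sum>v\<in>N. dN v * x v) - sum dN N"
    by (simp add: G_def algebra_simps sum_subtractf sum_distrib_left sum_distrib_right[symmetric] sum_divide_distrib[symmetric])
  moreover have "D = sum dN U - (\<Sum>v\<in>U. dN v * x v)"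
    by (simp add: D_def algebra_simps sum_subtractf)
  ultimately have gain: "2 * D + sum dU U < 2 * G"
    using large unfolding edges walks split[of "\<lambda>z. dN z * x z"] by simp
  have D0: "0 \<le> D" 
    unfolding D_def using x UV dN0 by (intro sum_nonneg mult_nonneg_nonneg) auto
  have dUU0: "0 \<le> sum dU U" by (intro sum_nonneg dU0)
  \<comment> \<open>The neighbours of \<open>v\<close> inside \<open>N\<close> are common neighbours
    of \<open>s\<close> and \<open>v\<close>.\<close>
  have dN_le: "dN v \<le> k" if "v \<in> N" for v
    using codeg[OF s(1), of v] that sum_nbhd[of "A v"] by (simp add: N_def dN_def)
  have "G \<le> (\<Sum>v\<in>N. k * x v)"
    unfolding G_def
  proof (rule sum_mono)
    fix v assume v: "v \<in> N"
    have "dN v * (x v - 1/2) \<le> dN v * x v" using dN0[of v] by (simp add: algebra_simps)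
    also have "\<dots> \<le> k * x v" using dN_le[OF v] x NV v by (intro mult_right_mono) auto
    finally show "dN v * (x v - 1/2) \<le> k * x v" .
  qed
  then have G_le: "G \<le> k * \<mu>" by (simp add: sum_distrib_left[symmetric] xN)
  \<comment> \<open>\<open>h w\<close> is the weight of \<open>N\<close> that \<open>w\<close> fails
    to see, out of the total \<mu>.\<close>
  define h where "h w = (\<Sum>v\<in>N. (1 - A w v) * x v)" for w
  have weight: "\<mu> * x w = \<mu> - h w + (\<Sum>u\<in>U. A w u * x u)" if "w \<in> V" for w
    using eig[OF that] xN by (simp add: split h_def algebra_simps sum_subtractf)
  have U_weight: "(\<Sum>u\<in>U. A w u * x u) \<le> dU w" for w
    unfolding dU_def using x UV A0 by (intro sum_mono mult_left_le) auto
  have N_weight: "\<mu> - h w \<le> dN w" for w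
  proof -
    have "\<mu> - h w = (\<Sum>v\<in>N. A w v * x v)"
      using xN by (simp add: h_def algebra_simps sum_subtractf)
    also have "\<dots> \<le> dN w"
      unfolding dN_def using x NV A0 by (intro sum_mono mult_left_le) auto
    finally show ?thesis .
  qed
  define U1 where "U1 = {w\<in>U. h w \<le> \<mu> / 2}"
  have finU1: "finite U1" and U1U: "U1 \<subseteq> U" using finU by (auto simp: U1_def)
  define r where "r w = dN w * (1 - x w)" for w
  have slack0: "0 \<le> c * r w + c' * dU w" if "w \<in> U" "0 \<le> c" "0 \<le> c'" for w c c'
    unfolding r_def using that x[of w] UV dN0[of w] dU0[of w] by (intro add_nonneg_nonneg mult_nonneg_nonneg) auto
  \<comment> \<open>the term \<open>dU\<close> of the loss absorbs the weight that \<open>w\<close> receives from \<open>U\<close>\<close>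
  have "sum h U1 \<le> (\<Sum>w\<in>U1. 2 * r w + 1 * dU w)"
  proof (rule sum_mono)
    fix w assume w: "w \<in> U1"
    then have wV: "w \<in> V" and h: "h w \<le> \<mu> / 2" using UV by (auto simp: U1_def)
    have "(\<mu> / 2) * (1 - x w) \<le> r w"
      unfolding r_def using N_weight[of w] h x[OF wV] by (intro mult_right_mono) auto
    then have "\<mu> - \<mu> * x w \<le> 2 * r w" by (simp add: algebra_simps)
    then show "h w \<le> 2 * r w + 1 * dU w"
      using weight[OF wV] U_weight[of w] by simp
  qed
  also have "\<dots> \<le> (\<Sum>w\<in>U. 2 * r w + 1 * dU w)"
    using slack0[of _ 2 1] by (intro sum_mono2 finU U1U) auto
  also have "\<dots> = 2 * D + sum dU U" by (simp add: D_def r_def[symmetric] sum.distrib sum_distrib_left)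
  finally have missing: "sum h U1 < 2 * G" using gain by simp
  \<comment> \<open>A vertex of \<open>U - U1\<close> with \<open>x w \<le> 3/4\<close> pays through
    \<open>r w\<close>. One with larger value sees less than half of the weight of \<open>N\<close>,
    so it must receive more than \<open>\<mu> / 4\<close> from \<open>U\<close> and pays through
    \<open>dU w\<close>.\<close>
  have "(\<Sum>w\<in>U-U1. \<mu> * x w) \<le> (\<Sum>w\<in>U-U1. 4 * r w + 4 * dU w)"
  proof (rule sum_mono)
    fix w assume w: "w \<in> U - U1"
    then have wV: "w \<in> V" and h: "h w > \<mu> / 2" using UV by (auto simp: U1_def)
    show "\<mu> * x w \<le> 4 * r w + 4 * dU w"
    proof (cases "x w \<le> 3/4")
      case True
      have "dN w * (1/4) \<le> r w" unfolding r_def using True dN0 by (intro mult_left_mono) auto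
      then show ?thesis using N_weight[of w] weight[OF wV] U_weight[of w] dU0[of w] by linarith
    next
      case False
      have "\<mu> * (3/4) \<le> \<mu> * x w" using False \<mu> by (intro mult_left_mono) auto
      moreover have "\<mu> * x w \<le> \<mu> * 1" using x[OF wV] \<mu> by (intro mult_left_mono) auto
      moreover have "0 \<le> r w" unfolding r_def using x[OF wV] dN0[of w] by simp
      ultimately show ?thesis using h weight[OF wV] U_weight[of w] by linarith
    qed
  qed
  also have "\<dots> \<le> (\<Sum>w\<in>U. 4 * r w + 4 * dU w)"
    using slack0[of _ 4 4] U1U by (intro sum_mono2 finU) auto
  also have "\<dots> = 4 * D + 4 * sum dU U" by (simp add: D_def r_def[symmetric] sum.distrib sum_distrib_left)
  also have "\<dots> \<le> 8 * (k * \<mu>)" using gain G_le D0 by linarith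
  finally have "\<mu> * (\<Sum>w\<in>U-U1. x w) \<le> \<mu> * (8 * k)" by (simp add: sum_distrib_left algebra_simps)
  then have low: "(\<Sum>w\<in>U-U1. x w) \<le> 8 * k" using \<mu> by simp
  have G_pos: "0 < G" using gain D0 dUU0 by linarith
  obtain v where v: "v \<in> N" "1/2 < x v"
  proof (rule ccontr)
    assume "\<not> thesis"
    then have "x v \<le> 1/2" if "v \<in> N" for v using that \<open>\<And>v. _ \<Longrightarrow> _ \<Longrightarrow> thesis\<close> by force
    then have "G \<le> 0" unfolding G_def using dN0 by (intro sum_nonpos mult_nonneg_nonpos) auto
    then show False using G_pos by simp
  qed
  \<comment> \<open>The neighbours of \<open>v\<close> have total weight above
    \<open>\<mu> / 2 \<ge> 12 * k\<close>. At most \<open>k\<close> of it lies in \<open>N\<close>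
    and at most \<open>8 * k\<close> in \<open>U - U1\<close>, which leaves more than
    \<open>3 * k\<close> for \<open>U1\<close>; this fixes the constant 24.\<close>
  have U1_large: "3 * k < real (card U1)"
  proof -
    have vV: "v \<in> V" using v NV by auto
    have 1: "(\<Sum>u\<in>N. A v u * x u) \<le> dN v"
      unfolding dN_def using x NV A0 by (intro sum_mono mult_left_le) auto
    have 2: "(\<Sum>u\<in>U. A v u * x u) \<le> (\<Sum>u\<in>U. x u)"
      using x UV A0 A1 by (intro sum_mono mult_left_le_one_le) auto
    have 3: "sum x U = sum x (U-U1) + sum x U1" using sum.subset_diff[OF U1U finU] .
    have "sum x U1 \<le> (\<Sum>u\<in>U1. 1)" using x UV U1U by (intro sum_mono) auto
    moreover have "\<mu> * (1/2) < \<mu> * x v" using v \<mu> by (intro mult_strict_left_mono) auto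
    ultimately show ?thesis using eig[OF vV] 1 2 3 low dN_le[OF v(1)] \<mu>(2)
      by (simp add: split[of "\<lambda>u. A v u * x u"])
  qed
  have k_pos: "0 < k"
  proof -
    have "0 < k * \<mu>" using G_pos G_le by linarith
    then show ?thesis using \<mu> by (simp add: zero_less_mult_iff)
  qed
  \<comment> \<open>\<open>a v\<close> is the number of vertices of \<open>U1\<close> not adjacent
    to \<open>v\<close>; \<open>h_a\<close> counts the missing pairs from both sides.\<close>
  define a where "a v = (\<Sum>w\<in>U1. 1 - A w v)" for v
  have a0: "0 \<le> a v" for v unfolding a_def using A1 by (intro sum_nonneg) auto
  have h_a: "sum h U1 = (\<Sum>v\<in>N. a v * x v)"
    unfolding h_def a_def by (subst sum.swap) (simp add: sum_distrib_right)
  have pair: "2 * k \<le> a v + a v'" if "v \<in> N" "v' \<in> N" "A v v' = 1" for v v'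
  proof -
    have "(\<Sum>w\<in>U1. A v w * A v' w) \<le> (\<Sum>w\<in>V. A v w * A v' w)"
      using U1U UV fin A0 by (intro sum_mono2) auto
    also have "\<dots> \<le> k" using that NV codeg by auto
    finally have "real (card U1) - k \<le> (\<Sum>w\<in>U1. 1 - A v w * A v' w)" by (simp add: sum_subtractf)
    also have "\<dots> \<le> (\<Sum>w\<in>U1. (1 - A w v) + (1 - A w v'))"
    proof (rule sum_mono)
      fix w show "1 - A v w * A v' w \<le> (1 - A w v) + (1 - A w v')"
        using A01[of v w] A01[of v' w] sym[of v w] sym[of v' w] by auto
    qed
    also have "\<dots> = a v + a v'" unfolding a_def by (rule sum.distrib)
    finally show ?thesis using U1_large by linarith
  qed
  \<comment> \<open>By symmetry of \<open>A\<close>, a sum over ordered adjacent pairs can be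
    collected at the first end.\<close>
  have dbl: "(\<Sum>v\<in>N. \<Sum>v'\<in>N. A v v' * (f v + f v')) = 2 * (\<Sum>v\<in>N. dN v * f v)" for f
  proof -
    have "(\<Sum>v\<in>N. \<Sum>v'\<in>N. A v v' * f v') = (\<Sum>v\<in>N. \<Sum>v'\<in>N. A v v' * f v)"
      by (subst sum.swap) (simp add: sym)
    then show ?thesis by (simp add: distrib_left sum.distrib dN_def sum_distrib_right)
  qed
  have "2 * k * (2 * G) = (\<Sum>v\<in>N. \<Sum>v'\<in>N. 2 * k * (A v v' * ((x v - 1/2) + (x v' - 1/2))))"
    unfolding sum_distrib_left[symmetric] dbl G_def by simp
  also have "\<dots> \<le> (\<Sum>v\<in>N. \<Sum>v'\<in>N. A v v' * (a v * x v + a v' * x v'))"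
  proof (intro sum_mono)
    fix v v' assume vv: "v \<in> N" "v' \<in> N"
    show "2 * k * (A v v' * ((x v - 1/2) + (x v' - 1/2))) \<le> A v v' * (a v * x v + a v' * x v')"
    proof (cases "A v v' = 1")
      case True
      \<comment> \<open>Both values are at most 1, so \<open>x v + x v' - 1\<close> is at most the
        smaller one, and \<open>pair\<close> then pays for it with missing pairs.\<close>
      let ?m = "min (x v) (x v')"
      have m: "0 \<le> ?m" "x v + x v' - 1 \<le> ?m" using x[of v] x[of v'] vv NV by auto
      have "2 * k * (x v + x v' - 1) \<le> 2 * k * ?m"
        using m k_pos by (intro mult_left_mono) auto
      also have "\<dots> \<le> (a v + a v') * ?m"
        using pair[OF vv True] m by (intro mult_right_mono) auto
      also have "\<dots> = a v * ?m + a v' * ?m" by (rule distrib_right)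
      also have "\<dots> \<le> a v * x v + a v' * x v'"
        using a0 by (intro add_mono mult_left_mono) auto
      finally show ?thesis using True by simp
    next
      case False
      then show ?thesis using A01[of v v'] by simp
    qed
  qed
  also have "\<dots> = 2 * (\<Sum>v\<in>N. dN v * (a v * x v))" by (rule dbl)
  \<comment> \<open>Each vertex of \<open>N\<close> is charged by at most \<open>k\<close>
    neighbours inside \<open>N\<close>, which cancels the factor \<open>k\<close> on the
    left.\<close>
  also have "\<dots> \<le> 2 * (\<Sum>v\<in>N. k * (a v * x v))"
    using dN_le a0 x NV by (intro mult_left_mono sum_mono mult_right_mono mult_nonneg_nonneg) auto
  also have "\<dots> = 2 * k * sum h U1" by (simp add: h_a sum_distrib_left mult.assoc)
  finally have "2 * G \<le> sum h U1" using k_pos by simp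
  then show False using missing by simp
qed

lemma largest_eigenvalue_gt_sqrt_imp_book:
  assumes G: "simple_graph V E"
    and large: "largest_eigenvalue V E > sqrt (real (card E))"
  shows "24 * real (bk V E) > largest_eigenvalue V E"
proof (rule ccontr)
  let ?\<mu> = "largest_eigenvalue V E"
  assume "\<not> 24 * real (bk V E) > ?\<mu>"
  then have small: "24 * real (bk V E) \<le> ?\<mu>" by simp
  have pos: "0 < ?\<mu>" using large real_sqrt_ge_zero[of "real (card E)"] by linarith
  have fin: "finite V" using G by (simp add: simple_graph_def)
  have ne: "V \<noteq> {}" using pos by (auto simp: largest_eigenvalue_def)
  obtain x where x: "\<And>v. 0 \<le> x v" "\<exists>v\<in>V. x v \<noteq> 0"
    "\<And>v. v \<in> V \<Longrightarrow> (\<Sum>u\<in>V. adj E v u * x u) = ?\<mu> * x v"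
    by (rule largest_eigenvalue_perron[OF G ne]) (rule that)
  \<comment> \<open>Dividing by the largest entry gives the normalisation
    \<open>x s = 1\<close>.\<close>
  have "Max (x ` V) \<in> x ` V" using fin ne by (intro Max_in) auto
  then obtain s where s: "s \<in> V" "x s = Max (x ` V)" by auto
  have s_max: "x v \<le> x s" if "v \<in> V" for v using that fin s(2) by simp
  obtain v where "v \<in> V" "x v \<noteq> 0" using x(2) by blast
  then have xs: "0 < x s" using x(1)[of v] s_max[of v] by linarith
  have "2 * ?\<mu>\<^sup>2 \<le> (\<Sum>u\<in>V. \<Sum>v\<in>V. adj E u v)"
  proof (rule no_small_codegree[where k = "real (bk V E)" and x = "\<lambda>v. x v / x s" and s = s])
    show "(\<Sum>w\<in>V. adj E u w * adj E v w) \<le> real (bk V E)" if "adj E u v = 1" for u v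
      using that common_nbrs_le_bk[OF G, of u v] by (simp only: sum_adj_mult_adj[OF fin]) (simp split: if_splits)
    show "(\<Sum>u\<in>V. adj E v u * (x u / x s)) = ?\<mu> * (x v / x s)" if "v \<in> V" for v
      using x(3)[OF that] by (simp add: sum_divide_distrib[symmetric])
    show "0 \<le> x v / x s \<and> x v / x s \<le> 1" if "v \<in> V" for v
      using x(1)[of v] s_max[OF that] xs by simp
    show "adj E u v = adj E v u" for u v by (rule adj_sym)
  qed (use fin s(1) xs pos small in simp_all)
  also have "\<dots> = 2 * (sqrt (real (card E)))\<^sup>2"
    using sum_adj_eq_twice_card_edges[OF G] by simp
  also have "\<dots> < 2 * ?\<mu>\<^sup>2"
    using large by (simp only: mult_less_cancel_left_pos zero_less_numeral) (intro power_strict_mono, auto)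
  finally show False by simp
qed

section \<open>The perturbed blow-up\<close>

definition tensor_adj :: "nat \<Rightarrow> nat \<Rightarrow> bool" where
  "tensor_adj u v \<longleftrightarrow> u mod 3 \<noteq> v mod 3 \<and> u mod 4 \<noteq> v mod 4"

text \<open>By the Chinese remainder theorem, the residues modulo 3 and 4 give the classes of the tensor
  product of \<open>K\<^sub>3\<close> and \<open>K\<^sub>4\<close>. Deleting 4 and 9 and adding \<open>12 t\<close> and \<open>12 t + 1\<close> moves a vertex from each
  of the classes (1, 0) and (0, 1) to the classes (0, 0) and (1, 1).\<close>

definition tensor_verts :: "nat \<Rightarrow> nat set" where
  "tensor_verts t = {..<12 * t + 2} - {4, 9}"

definition tensor_edges :: "nat \<Rightarrow> nat set set" where
  "tensor_edges t = {{u, v} |u v. u \<in> tensor_verts t \<and> v \<in> tensor_verts t \<and> tensor_adj u v}"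

lemma doubleton_in_tensor_edges_iff:
  "{u, v} \<in> tensor_edges t \<longleftrightarrow> u \<in> tensor_verts t \<and> v \<in> tensor_verts t \<and> tensor_adj u v"
  by (auto simp: tensor_edges_def doubleton_eq_iff tensor_adj_def)

lemma simple_graph_tensor: "simple_graph (tensor_verts t) (tensor_edges t)"
  by (auto simp: simple_graph_def tensor_edges_def tensor_verts_def tensor_adj_def card_insert_if)

section \<open>Sums over the residue classes modulo 12\<close>

lemma sum_lessThan_12: "(\<Sum>c<12. f c) =
    f 0 + f 1 + f 2 + f 3 + f 4 + f 5 + f 6 + f 7 + f 8 + f 9 + f 10 + f 11" for f :: "nat \<Rightarrow> real"
  by (simp add: eval_nat_numeral)

lemma sum_periodic:
  fixes f :: "nat \<Rightarrow> real"
  assumes "\<And>v. f (v mod 12) = f v"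
  shows "(\<Sum>v<12 * t. f v) = real t * (\<Sum>c<12. f c)"
proof -
  have "(\<Sum>v<12 * t. f v) = (\<Sum>m<t. \<Sum>v=m * 12..<m * 12 + 12. f v)"
    by (simp add: sum.nat_group mult.commute)
  also have "\<dots> = (\<Sum>m<t. \<Sum>c<12. f c)"
  proof (rule sum.cong[OF refl])
    fix m
    have "(\<Sum>v=m * 12..<m * 12 + 12. f v) = (\<Sum>c<12. f (c + m * 12))"
      using sum.shift_bounds_nat_ivl[of f 0 "m * 12" 12] by (simp add: atLeast0LessThan add.commute)
    also have "\<dots> = (\<Sum>c<12. f c)"
      using assms by (intro sum.cong) (metis mod_mult_self1 refl)+
    finally show "(\<Sum>v=m * 12..<m * 12 + 12. f v) = (\<Sum>c<12. f c)" .
  qed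
  finally show ?thesis by simp
qed

lemma tensor_adj_mod: "tensor_adj u (v mod 12) \<longleftrightarrow> tensor_adj u v" "tensor_adj (u mod 12) v \<longleftrightarrow> tensor_adj u v"
proof -
  have "v mod 12 mod 3 = v mod 3" "v mod 12 mod 4 = v mod 4" for v :: nat
    by (simp_all add: mod_mod_cancel)
  then show "tensor_adj u (v mod 12) \<longleftrightarrow> tensor_adj u v" "tensor_adj (u mod 12) v \<longleftrightarrow> tensor_adj u v"
    by (simp_all add: tensor_adj_def)
qed

lemma tensor_adj_shift: "tensor_adj u (12 * t) \<longleftrightarrow> tensor_adj u 0" "tensor_adj u (12 * t + 1) \<longleftrightarrow> tensor_adj u 1"
  "tensor_adj (12 * t) u \<longleftrightarrow> tensor_adj 0 u" "tensor_adj (12 * t + 1) u \<longleftrightarrow> tensor_adj 1 u"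
proof -
  have "(12 * t) mod 12 = 0" "(12 * t + 1) mod 12 = 1" by simp_all
  then show "tensor_adj u (12 * t) \<longleftrightarrow> tensor_adj u 0" "tensor_adj u (12 * t + 1) \<longleftrightarrow> tensor_adj u 1"
    "tensor_adj (12 * t) u \<longleftrightarrow> tensor_adj 0 u" "tensor_adj (12 * t + 1) u \<longleftrightarrow> tensor_adj 1 u"
    by (metis tensor_adj_mod)+
qed

text \<open>A class has 2 choices for the other residue modulo 3 and 3 for the one modulo 4. The
  check is exhaustive once the residues of \<open>u\<close> are replaced by variables.\<close>

lemma sum_tensor_adj: "(\<Sum>c<12. of_bool (tensor_adj u c)) = (6 :: real)"
proof -
  have key: "\<forall>i\<in>{0, 1, 2 :: nat}. \<forall>j\<in>{0, 1, 2, 3 :: nat}. (\<Sum>c<12. of_bool (i \<noteq> c mod 3 \<and> j \<noteq> c mod 4)) = (6 :: real)"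
    unfolding sum_lessThan_12 by simp
  have "u mod 3 \<in> {0, 1, 2}" "u mod 4 \<in> {0, 1, 2, 3}" by auto
  then show ?thesis unfolding tensor_adj_def by (rule key[rule_format])
qed

text \<open>Two adjacent classes differ in both residues, which leaves 1 residue modulo 3 and 2
  modulo 4.\<close>

lemma sum_tensor_adj_adj:
  assumes "tensor_adj u v"
  shows "(\<Sum>c<12. of_bool (tensor_adj u c \<and> tensor_adj v c)) = (2 :: real)"
proof -
  have key: "\<forall>i\<in>{0, 1, 2 :: nat}. \<forall>i'\<in>{0, 1, 2}. \<forall>j\<in>{0, 1, 2, 3 :: nat}. \<forall>j'\<in>{0, 1, 2, 3}. i \<noteq> i' \<longrightarrow> j \<noteq> j' \<longrightarrow>
      (\<Sum>c<12. of_bool ((i \<noteq> c mod 3 \<and> j \<noteq> c mod 4) \<and> (i' \<noteq> c mod 3 \<and> j' \<noteq> c mod 4))) = (2 :: real)"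
    unfolding sum_lessThan_12 by simp
  have mods: "w mod 3 \<in> {0, 1, 2}" "w mod 4 \<in> {0, 1, 2, 3}" for w :: nat by auto
  show ?thesis
    using assms unfolding tensor_adj_def by (intro key[rule_format] mods) auto
qed

lemma sum_tensor_verts:
  fixes f :: "nat \<Rightarrow> real"
  assumes "1 \<le> t"
  shows "(\<Sum>v\<in>tensor_verts t. f v) = (\<Sum>v<12 * t. f v) + f (12 * t) + f (12 * t + 1) - f 4 - f 9"
proof -
  \<comment> \<open>From \<open>t = 1\<close> on, both deleted numbers really occur in the
    range.\<close>
  have "{4, 9} \<subseteq> {..<12 * t + 2}" using assms by auto
  then show ?thesis unfolding tensor_verts_def by (simp add: sum_diff)
qed

lemma card_tensor_verts:
  assumes "1 \<le> t"
  shows "real (card (tensor_verts t)) = 12 * real t"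
  using sum_tensor_verts[OF assms, of "\<lambda>_. 1"] by simp

text \<open>The change of class sizes is the tensor product of (1, -1, 0) and (1, -1, 0, 0), with
  eigenvalue (-1)(-1) = 1. Its entries sum to 0, so the cross terms vanish and its squared norm 4 is
  added to the degree sum.\<close>

lemma card_tensor_edges:
  assumes t: "1 \<le> t"
  shows "real (card (tensor_edges t)) = 36 * (real t)\<^sup>2 + 2"
proof -
  define d where "d u = 6 * real t + of_bool (tensor_adj u 0) + of_bool (tensor_adj u 1) - of_bool (tensor_adj u 4) - of_bool (tensor_adj u 9)" for u
  have "(\<Sum>v\<in>tensor_verts t. adj (tensor_edges t) u v) = d u" if "u \<in> tensor_verts t" for u
  proof -
    have "(\<Sum>v\<in>tensor_verts t. adj (tensor_edges t) u v) = (\<Sum>v\<in>tensor_verts t. of_bool (tensor_adj u v))"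
      using that by (intro sum.cong) (auto simp: doubleton_in_tensor_edges_iff)
    also have "\<dots> = d u"
      unfolding sum_tensor_verts[OF t] sum_periodic[of "\<lambda>v. of_bool (tensor_adj u v)", unfolded tensor_adj_mod, OF refl]
        sum_tensor_adj tensor_adj_shift d_def by simp
    finally show ?thesis .
  qed
  then have "2 * real (card (tensor_edges t)) = (\<Sum>u\<in>tensor_verts t. d u)"
    unfolding sum_adj_eq_twice_card_edges[OF simple_graph_tensor, symmetric] by (intro sum.cong) auto
  also have "\<dots> = real t * (\<Sum>c<12. d c) + d (12 * t) + d (12 * t + 1) - d 4 - d 9"
    unfolding sum_tensor_verts[OF t] by (subst sum_periodic) (simp_all add: d_def tensor_adj_mod)
  also have "\<dots> = 72 * (real t)\<^sup>2 + 4"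
    unfolding d_def tensor_adj_shift sum_lessThan_12 by (simp add: tensor_adj_def power2_eq_square)
  finally show ?thesis by simp
qed

lemma bk_tensor_le:
  assumes t: "1 \<le> t"
  shows "bk (tensor_verts t) (tensor_edges t) \<le> 2 * t + 2"
proof (rule bk_leI[OF simple_graph_tensor])
  fix u v assume "{u, v} \<in> tensor_edges t"
  then have uv: "u \<in> tensor_verts t" "v \<in> tensor_verts t" "tensor_adj u v"
    by (auto simp: doubleton_in_tensor_edges_iff)
  define f where "f w = (of_bool (tensor_adj u w \<and> tensor_adj v w) :: real)" for w
  have fin: "finite (tensor_verts t)" by (simp add: tensor_verts_def)
  have "real (card (common_nbrs (tensor_verts t) (tensor_edges t) u v)) = sum f (tensor_verts t)"
    unfolding sum_adj_mult_adj[OF fin, symmetric] f_def using uv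
    by (intro sum.cong) (auto simp: doubleton_in_tensor_edges_iff)
  \<comment> \<open>Each of the two added vertices contributes at most 1, and the deletions only
    help.\<close>
  also have "\<dots> \<le> (\<Sum>w<12 * t. f w) + 1 + 1 - 0 - 0"
    unfolding sum_tensor_verts[OF t] by (intro add_mono diff_mono) (auto simp: f_def)
  also have "\<dots> = real (2 * t + 2)"
    using sum_periodic[of f t] sum_tensor_adj_adj[OF uv(3)] by (simp add: f_def tensor_adj_mod)
  finally show "card (common_nbrs (tensor_verts t) (tensor_edges t) u v) \<le> 2 * t + 2"
    by linarith
qed

text \<open>The constant vector is a test vector for the Rayleigh quotient.\<close>

lemma largest_eigenvalue_ge_average_degree:
  assumes G: "simple_graph V E" and ne: "V \<noteq> {}"
  shows "2 * real (card E) \<le> largest_eigenvalue V E * real (card V)"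
proof -
  have "(\<Sum>u\<in>V. \<Sum>v\<in>V. adj E u v * y u * y v)
      \<le> largest_eigenvalue V E * (\<Sum>v\<in>V. (y v)\<^sup>2)" for y
    by (rule largest_eigenvalue_perron[OF G ne])
  from this[of "\<lambda>_. 1"] show ?thesis
    using sum_adj_eq_twice_card_edges[OF G] by simp
qed

lemma largest_eigenvalue_tensor:
  assumes t: "1 \<le> t"
  shows "largest_eigenvalue (tensor_verts t) (tensor_edges t) > sqrt (real (card (tensor_edges t)))"
proof -
  let ?\<mu> = "largest_eigenvalue (tensor_verts t) (tensor_edges t)"
  have T: "0 < real t" using t by simp
  have "tensor_verts t \<noteq> {}" using card_tensor_verts[OF t] t by auto
  then have "2 * (36 * (real t)\<^sup>2 + 2) \<le> ?\<mu> * (12 * real t)"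
    using largest_eigenvalue_ge_average_degree[OF simple_graph_tensor, of t]
    by (simp add: card_tensor_verts[OF t] card_tensor_edges[OF t])
  then have "6 * real t + 1 / (3 * real t) \<le> ?\<mu>"
    using T by (simp add: field_simps power2_eq_square)
  \<comment> \<open>The average degree is \<open>6 * t + 1 / (3 * t)\<close>; the cross term of its
    square is 4, which beats the 2 extra edges.\<close>
  moreover have "sqrt (36 * (real t)\<^sup>2 + 2) < 6 * real t + 1 / (3 * real t)"
  proof (rule real_less_lsqrt)
    have "(6 * real t + 1 / (3 * real t))\<^sup>2 = 36 * (real t)\<^sup>2 + 4 + (1 / (3 * real t))\<^sup>2"
      using T by (simp add: field_simps power2_eq_square)
    then show "36 * (real t)\<^sup>2 + 2 < (6 * real t + 1 / (3 * real t))\<^sup>2" by (simp add: add_pos_nonneg)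
  qed (use T in auto)
  ultimately show ?thesis by (simp add: card_tensor_edges[OF t])
qed

theorem theorem1p2:
  shows "(\<forall>(V :: 'a set) E.
            simple_graph V E \<and> largest_eigenvalue V E > sqrt (real (card E)) \<longrightarrow>
            real (bk V E) > 1 / 144 * sqrt (real (card E)))
       \<and> (\<exists>\<epsilon> :: nat \<Rightarrow> real. \<epsilon> \<longlonglongrightarrow> 0 \<and>
            infinite {m. \<exists>(V :: nat set) E.
              simple_graph V E \<and> card E = m \<and>
              largest_eigenvalue V E > sqrt (real m) \<and>
              real (bk V E) \<le> (1 / 3 + \<epsilon> m) * sqrt (real m)})"
proof (intro conjI allI impI)
  fix V :: "'a set" and E
  assume "simple_graph V E \<and> largest_eigenvalue V E > sqrt (real (card E))"
  then show "real (bk V E) > 1 / 144 * sqrt (real (card E))"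
    \<comment> \<open>The bound obtained has 1/24 in place of 1/144.\<close>
    using largest_eigenvalue_gt_sqrt_imp_book[of V E] real_sqrt_ge_zero[of "real (card E)"] by linarith
next
  \<comment> \<open>Chosen so that \<open>\<epsilon> m * sqrt m = 2\<close> for positive
    \<open>m\<close>, the additive constant in the book bound \<open>2 * t + 2\<close>.\<close>
  define \<epsilon> where "\<epsilon> m = 2 / sqrt (real m)" for m
  have lim: "\<epsilon> \<longlonglongrightarrow> 0"
    unfolding \<epsilon>_def
    by (intro real_tendsto_divide_at_top[OF tendsto_const]
        filterlim_compose[OF sqrt_at_top] filterlim_real_sequentially)
  let ?M = "{m. \<exists>(V :: nat set) E. simple_graph V E \<and> card E = m \<and>
              largest_eigenvalue V E > sqrt (real m) \<and>
              real (bk V E) \<le> (1 / 3 + \<epsilon> m) * sqrt (real m)}"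
  have m: "card (tensor_edges t) = 36 * t\<^sup>2 + 2" if "1 \<le> t" for t
  proof -
    have "real (card (tensor_edges t)) = real (36 * t\<^sup>2 + 2)"
      using card_tensor_edges[OF that] by simp
    then show ?thesis by (simp only: of_nat_eq_iff)
  qed
  have "36 * t\<^sup>2 + 2 \<in> ?M" if t: "1 \<le> t" for t :: nat
  proof -
    let ?m = "36 * t\<^sup>2 + 2"
    have "6 * real t \<le> sqrt (real ?m)" by (rule real_le_rsqrt) (simp add: power_mult_distrib)
    moreover have "(1 / 3 + \<epsilon> ?m) * sqrt (real ?m) = sqrt (real ?m) / 3 + 2"
    proof -
      have "0 < sqrt (real ?m)" unfolding real_sqrt_gt_0_iff of_nat_0_less_iff by simp
      then show ?thesis by (simp add: \<epsilon>_def distrib_right)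
    qed
    moreover have "real (bk (tensor_verts t) (tensor_edges t)) \<le> 2 * real t + 2"
      using bk_tensor_le[OF t] by linarith
    ultimately have "real (bk (tensor_verts t) (tensor_edges t)) \<le> (1 / 3 + \<epsilon> ?m) * sqrt (real ?m)"
      by linarith
    moreover have "largest_eigenvalue (tensor_verts t) (tensor_edges t) > sqrt (real ?m)"
      using largest_eigenvalue_tensor[OF t] m[OF t] by simp
    ultimately show ?thesis using simple_graph_tensor m[OF t] by blast
  qed
  then have "(\<lambda>t. 36 * t\<^sup>2 + 2) ` {1..} \<subseteq> ?M" by auto
  moreover have "infinite ((\<lambda>t::nat. 36 * t\<^sup>2 + 2) ` {1..})"
    by (subst finite_image_iff) (auto simp: inj_on_def infinite_Ici)
  ultimately have "infinite ?M" using infinite_super by blast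
  with lim show "\<exists>\<epsilon> :: nat \<Rightarrow> real. \<epsilon> \<longlonglongrightarrow> 0 \<and>
            infinite {m. \<exists>(V :: nat set) E.
              simple_graph V E \<and> card E = m \<and>
              largest_eigenvalue V E > sqrt (real m) \<and>
              real (bk V E) \<le> (1 / 3 + \<epsilon> m) * sqrt (real m)}" by blast
qed

end
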